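(* Let $d,m_1,m_2\in\mathbb{N}$ with $m_1,m_2\le d$, let $H_1\in\mathbb{R}^{m_1\times d}$, $H_2\in\mathbb{R}^{m_2\times d}$, $y_1\in\mathbb{R}^{m_1}$, $y_2\in\mathbb{R}^{m_2}$, and suppose that the systems of linear equations $H_1x=y_1$ and $H_2x=y_2$ (in the unknown $x\in\mathbb{R}^d$) have the same non-trivial (i.e. non-empty) solution set. Then $H_1\theta=y_1$ and $H_2\theta=y_2$ are two ways to express the same null hypothesis on a parameter $\theta\in\mathbb{R}^d$ (that is, for every $\theta\in\mathbb{R}^d$, $H_1\theta=y_1$ if and only if $H_2\theta=y_2$), and if $\Sigma>0$ (positive definite), the values of the two corresponding Wald-type statistics coincide: $$WTS(H_1,y_1)=WTS(H_2,y_2).$$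
   Context: $X$ denotes a data set with total sample size $N$, and $T(X)$ is an $\mathbb{R}^d$-valued statistic with covariance matrix $\Sigma=\mathrm{Cov}(T(X))\in\mathbb{R}^{d\times d}$, which is symmetric positive semidefinite. $A^+$ denotes the Moore–Penrose inverse of a matrix $A$. For $H\in\mathbb{R}^{m\times d}$ and $y\in\mathbb{R}^m$, the Wald-type statistic is $$WTS(H,y)=N\cdot (HT(X)-y)^\top (H\Sigma H^\top)^+(HT(X)-y).$$ *)

theory Defs
  imports "HOL-Analysis.Analysis" "HOL-Probability.Probability"
begin

definition square_integrable :: "'w measure \<Rightarrow> ('w \<Rightarrow> real ^ 'd) \<Rightarrow> bool" where
  "square_integrable M Z \<longleftrightarrow>
     Z \<in> borel_measurable M \<and> (\<forall>i. integrable M (\<lambda>w. (Z w $ i)\<^sup>2))"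

(* Only meaningful for square-integrable Z: otherwise the Bochner integral defaults to 0. *)
definition covariance_matrix :: "'w measure \<Rightarrow> ('w \<Rightarrow> real ^ 'd) \<Rightarrow> real ^ 'd ^ 'd" where
  "covariance_matrix M Z =
     (\<chi> i j. integral\<^sup>L M (\<lambda>w. (Z w $ i - integral\<^sup>L M (\<lambda>v. Z v $ i)) *
                                 (Z w $ j - integral\<^sup>L M (\<lambda>v. Z v $ j))))"

definition positive_definite :: "real ^ 'd ^ 'd \<Rightarrow> bool" where
  "positive_definite A \<longleftrightarrow> transpose A = A \<and> (\<forall>x. x \<noteq> 0 \<longrightarrow> x \<bullet> (A *v x) > 0)"

(* The four Penrose equations; over the reals the conjugate transpose is the transpose. *)
definition is_moore_penrose_inverse :: "real ^ 'n ^ 'm \<Rightarrow> real ^ 'm ^ 'n \<Rightarrow> bool" where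
  "is_moore_penrose_inverse A B \<longleftrightarrow>
     A ** B ** A = A \<and>
     B ** A ** B = B \<and>
     transpose (A ** B) = A ** B \<and>
     transpose (B ** A) = B ** A"

lemma is_moore_penrose_inverse_unique:
  assumes B: "is_moore_penrose_inverse A B" and C: "is_moore_penrose_inverse A C"
  shows "B = C"
proof -
  have AB: "A ** B = A ** C"
  proof -
    have "A ** B = transpose ((A ** C) ** (A ** B))"
      using B C unfolding is_moore_penrose_inverse_def by (metis matrix_mul_assoc)
    also have "\<dots> = (A ** B) ** (A ** C)"
      using B C unfolding is_moore_penrose_inverse_def by (metis matrix_transpose_mul)
    also have "\<dots> = A ** C"
      using B unfolding is_moore_penrose_inverse_def by (metis matrix_mul_assoc)
    finally show ?thesis .
  qed
  have BA: "B ** A = C ** A"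
  proof -
    have "B ** A = transpose ((B ** A) ** (C ** A))"
      using B C unfolding is_moore_penrose_inverse_def by (metis matrix_mul_assoc)
    also have "\<dots> = (C ** A) ** (B ** A)"
      using B C unfolding is_moore_penrose_inverse_def by (metis matrix_transpose_mul)
    also have "\<dots> = C ** A"
      using B unfolding is_moore_penrose_inverse_def by (metis matrix_mul_assoc)
    finally show ?thesis .
  qed
  have "B = B ** A ** B" using B by (simp add: is_moore_penrose_inverse_def)
  also have "\<dots> = C ** (A ** B)" by (simp add: BA matrix_mul_assoc)
  also have "\<dots> = C ** A ** C" by (simp add: AB matrix_mul_assoc)
  also have "\<dots> = C" using C by (simp add: is_moore_penrose_inverse_def)
  finally show ?thesis .
qed

definition moore_penrose_inverse :: "real ^ 'n ^ 'm \<Rightarrow> real ^ 'm ^ 'n" where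
  "moore_penrose_inverse A = (THE B. is_moore_penrose_inverse A B)"

(* Cv stands for the covariance matrix usually written Sigma (a constant of HOL), N for the total
   sample size and t for the observed value of T(X). *)
definition WTS ::
  "nat \<Rightarrow> real ^ 'd ^ 'd \<Rightarrow> real ^ 'd \<Rightarrow> real ^ 'd ^ 'm \<Rightarrow> real ^ 'm \<Rightarrow> real" where
  "WTS N Cv t H y =
     real N * ((H *v t - y) \<bullet>
       (moore_penrose_inverse (H ** Cv ** transpose H) *v (H *v t - y)))"

end

(* With a common solution x0 and v = T(X) - x0, the statistic is N times the quadratic form in v
   of P = H^T (H Cv H^T)^+ H. This P is symmetric and satisfies H Cv P = H, because Cv is positive
   definite. If H1 and H2 have the same kernel, then H1 Cv P1 = H1 yields H2 Cv P1 = H2, hence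
   P2 Cv P1 = P2, and likewise P1 Cv P2 = P1; transposing the latter gives P1 = P2. *)

theory Submission
  imports Defs
begin

text \<open>\<open>G\<close> is the matrix of a linear right inverse of \<open>A\<close> on its
  range; every \<open>A *v x\<close> lies in that range.\<close>

lemma matrix_inner_inverse_exists:
  fixes A :: "real ^ 'n ^ 'm"
  obtains G where "A ** G ** A = A"
proof -
  obtain g where g: "linear g" "\<forall>v\<in>range ((*v) A). A *v (g v) = v"
    using real_vector.linear_exists_right_inverse_on[of "(*v) A" UNIV] by auto
  have "(A ** matrix g ** A) *v x = A *v x" for x
    using g by (simp add: matrix_vector_mul_assoc[symmetric] matrix_works)
  then show thesis
    using that by (metis matrix_eq)
qed

lemma positive_definite_mat_1: "positive_definite (mat 1)"
  by (simp add: positive_definite_def)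

text \<open>For z = W^T x the form z . S z equals x . (W S W^T) x = 0, so definiteness forces z =
  0.\<close>

lemma positive_definite_cancel:
  fixes W :: "real ^ 'd ^ 'm"
  assumes S: "positive_definite S" and W: "W ** S ** transpose W = 0"
  shows "W = 0"
proof -
  have "transpose W *v x = 0" for x
  proof -
    let ?z = "transpose W *v x"
    have "?z \<bullet> (S *v ?z) = x \<bullet> ((W ** S ** transpose W) *v x)"
      by (simp add: dot_lmul_matrix matrix_vector_mul_assoc[symmetric])
    then show ?thesis
      using S by (force simp: W positive_definite_def)
  qed
  then have "transpose W = 0"
    by (simp add: matrix_eq)
  then show ?thesis
    by (simp add: vec_eq_iff transpose_def)
qed

text \<open>Cancels \<open>S ** transpose H\<close> on the right: W = (C - 1) H satisfies W S W^T =
  0, hence W = 0.\<close>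

lemma positive_definite_congruence_cancel:
  fixes C :: "real ^ 'm ^ 'm" and H :: "real ^ 'd ^ 'm"
  assumes S: "positive_definite S" and eq: "C ** (H ** S ** transpose H) = H ** S ** transpose H"
  shows "C ** H = H"
proof -
  have diff: "(C - mat 1) ** B = C ** B - B" for B :: "real ^ 'k ^ 'm"
    by (simp add: matrix_eq matrix_vector_mul_assoc[symmetric] matrix_vector_mult_diff_rdistrib)
  have "((C - mat 1) ** H) ** S ** transpose ((C - mat 1) ** H)
        = ((C - mat 1) ** (H ** S ** transpose H)) ** transpose (C - mat 1)"
    by (simp add: matrix_transpose_mul matrix_mul_assoc)
  also have "(C - mat 1) ** (H ** S ** transpose H) = 0"
    by (simp only: diff eq diff_self)
  finally have "(C - mat 1) ** H = 0"
    using positive_definite_cancel[OF S] by simp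
  then show ?thesis
    by (simp add: diff)
qed

text \<open>As in the normal equations, take C = G A^T with G an inner inverse of the Gram matrix
  A^T A. Then A C turns out to be the orthogonal projection onto the range of A.\<close>

lemma matrix_least_squares_inverse_exists:
  fixes A :: "real ^ 'n ^ 'm"
  obtains C where "A ** C ** A = A" "transpose (A ** C) = A ** C"
proof -
  obtain G where G: "(transpose A ** A) ** G ** (transpose A ** A) = transpose A ** A"
    by (rule matrix_inner_inverse_exists)
  let ?C = "G ** transpose A"
  let ?U = "A ** ?C"
  \<comment> \<open>The identity and the double transpose put \<open>G\<close> into the shape H S
    H^T with H = A^T and S = 1, so that the trailing factor A can be cancelled.\<close>
  have "(transpose A ** A ** G) ** (transpose A ** mat 1 ** transpose (transpose A))
      = transpose A ** mat 1 ** transpose (transpose A)"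
    using G by simp
  then have "(transpose A ** A ** G) ** transpose A = transpose A"
    by (rule positive_definite_congruence_cancel[OF positive_definite_mat_1])
  then have "transpose A ** ?U = transpose A"
    by (simp add: matrix_mul_assoc)
  then have UtA: "transpose ?U ** A = A"
    by (metis matrix_transpose_mul transpose_transpose)
  \<comment> \<open>\<open>?U\<close> starts with the factor \<open>A\<close>, which
    \<open>transpose ?U\<close> fixes; U^T U is symmetric, hence so is U.\<close>
  then have "transpose ?U ** ?U = ?U"
    by (simp add: matrix_mul_assoc)
  then have sym: "transpose ?U = ?U"
    by (metis matrix_transpose_mul transpose_transpose)
  with UtA have "?U ** A = A"
    by simp
  from this sym show thesis
    by (rule that)
qed

text \<open>If C makes A C symmetric and D makes D A symmetric, both being inner inverses of A, then
  B = D A C has A B = A C and B A = D A.\<close>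

lemma is_moore_penrose_inverse_exists:
  fixes A :: "real ^ 'n ^ 'm"
  obtains B where "is_moore_penrose_inverse A B"
proof -
  obtain C where C: "A ** C ** A = A" "transpose (A ** C) = A ** C"
    by (rule matrix_least_squares_inverse_exists)
  obtain E where E: "transpose A ** E ** transpose A = transpose A"
      "transpose (transpose A ** E) = transpose A ** E"
    by (rule matrix_least_squares_inverse_exists)
  define D where "D = transpose E"
  have D: "A ** D ** A = A" "transpose (D ** A) = D ** A"
    using E by (metis D_def matrix_mul_assoc matrix_transpose_mul transpose_transpose)+
  have AB: "A ** (D ** A ** C) = A ** C" and BA: "D ** A ** C ** A = D ** A"
    using C(1) D(1) by (metis matrix_mul_assoc)+
  have "is_moore_penrose_inverse A (D ** A ** C)"
    unfolding is_moore_penrose_inverse_def AB BA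
    using C D by (metis matrix_mul_assoc)
  then show thesis
    by (rule that)
qed

lemma moore_penrose_inverse_is_inverse:
  "is_moore_penrose_inverse A (moore_penrose_inverse A)"
  unfolding moore_penrose_inverse_def
  by (metis is_moore_penrose_inverse_exists is_moore_penrose_inverse_unique theI)

text \<open>Transposing the Penrose equations exchanges the two symmetry conditions; uniqueness does
  the rest.\<close>

lemma transpose_moore_penrose_inverse:
  "transpose (moore_penrose_inverse A) = moore_penrose_inverse (transpose A)"
proof (rule is_moore_penrose_inverse_unique)
  show "is_moore_penrose_inverse (transpose A) (transpose (moore_penrose_inverse A))"
    using moore_penrose_inverse_is_inverse[of A]
    unfolding is_moore_penrose_inverse_def
    by (metis matrix_mul_assoc matrix_transpose_mul)
qed (rule moore_penrose_inverse_is_inverse)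

text \<open>Its type does not depend on the number of rows of \<open>H\<close>, so the matrices of
  two differently sized systems can be compared.\<close>

definition wald_matrix :: "real ^ 'd ^ 'd \<Rightarrow> real ^ 'd ^ 'm \<Rightarrow> real ^ 'd ^ 'd" where
  "wald_matrix S H = transpose H ** moore_penrose_inverse (H ** S ** transpose H) ** H"

lemma transpose_wald_matrix:
  assumes "transpose S = S"
  shows "transpose (wald_matrix S H) = wald_matrix S H"
  by (simp add: wald_matrix_def matrix_transpose_mul transpose_moore_penrose_inverse assms
      matrix_mul_assoc)

text \<open>With A = H S H^T, the Penrose equation A A^+ A = A cancels to A A^+ H = H, which is the
  claim up to bracketing.\<close>

lemma wald_matrix_reproduces:
  fixes H :: "real ^ 'd ^ 'm"
  assumes S: "positive_definite S"
  shows "H ** S ** wald_matrix S H = H"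
proof -
  let ?A = "H ** S ** transpose H"
  let ?B = "moore_penrose_inverse ?A"
  have "(?A ** ?B) ** ?A = H ** S ** transpose H"
    using moore_penrose_inverse_is_inverse[of ?A] by (simp add: is_moore_penrose_inverse_def)
  then have "(?A ** ?B) ** H = H"
    by (rule positive_definite_congruence_cancel[OF S])
  then show ?thesis
    by (simp add: wald_matrix_def matrix_mul_assoc)
qed

text \<open>By reproduction, S P x - x lies in the kernel of H, where P =
  \<open>wald_matrix S H\<close>, hence in that of K. Thus K S P = K, and K is the last factor of
  \<open>wald_matrix S K\<close>.\<close>

lemma wald_matrix_absorb:
  fixes H :: "real ^ 'd ^ 'm" and K :: "real ^ 'd ^ 'k"
  assumes S: "positive_definite S" and ker: "\<And>x. H *v x = 0 \<Longrightarrow> K *v x = 0"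
  shows "wald_matrix S K ** S ** wald_matrix S H = wald_matrix S K"
proof -
  have "K *v (S ** wald_matrix S H *v x) = K *v x" for x
  proof -
    have "H *v (S ** wald_matrix S H *v x - x) = 0"
      using wald_matrix_reproduces[OF S, of H]
      by (simp add: matrix_vector_mult_diff_distrib matrix_vector_mul_assoc matrix_mul_assoc)
    from ker[OF this] show ?thesis
      by (simp add: matrix_vector_mult_diff_distrib)
  qed
  then have "K ** (S ** wald_matrix S H) = K"
    by (simp add: matrix_eq matrix_vector_mul_assoc)
  then show ?thesis
    unfolding wald_matrix_def[of S K] by (metis matrix_mul_assoc)
qed

lemma wald_matrix_cong_kernel:
  fixes H :: "real ^ 'd ^ 'm" and K :: "real ^ 'd ^ 'k"
  assumes S: "positive_definite S" and ker: "\<And>x. H *v x = 0 \<longleftrightarrow> K *v x = 0"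
  shows "wald_matrix S H = wald_matrix S K"
proof -
  have sym: "transpose S = S"
    using S by (simp add: positive_definite_def)
  have "wald_matrix S H = transpose (wald_matrix S H ** S ** wald_matrix S K)"
    using wald_matrix_absorb[OF S, of K H] ker by (simp add: transpose_wald_matrix sym)
  also have "\<dots> = wald_matrix S K ** S ** wald_matrix S H"
    by (simp add: matrix_transpose_mul transpose_wald_matrix sym matrix_mul_assoc)
  also have "\<dots> = wald_matrix S K"
    using wald_matrix_absorb[OF S, of H K] ker by simp
  finally show ?thesis .
qed

text \<open>A solution x turns the residual H t - y into H (t - x), and H then moves across the
  inner product.\<close>

lemma WTS_eq_wald_matrix:
  assumes "H *v x = y"
  shows "WTS N S t H y = real N * ((t - x) \<bullet> (wald_matrix S H *v (t - x)))"
proof -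
  have "H *v t - y = H *v (t - x)"
    by (simp add: assms matrix_vector_mult_diff_distrib)
  moreover have "(t - x) \<bullet> (transpose H *v z) = (H *v (t - x)) \<bullet> z" for z
    by (metis dot_lmul_matrix inner_commute transpose_matrix_vector)
  ultimately show ?thesis
    by (simp add: WTS_def wald_matrix_def matrix_vector_mul_assoc[symmetric]
        del: transpose_matrix_vector)
qed

text \<open>The kernel is the solution set translated by minus one common solution: u lies in it
  exactly when x + u is a solution.\<close>

lemma kernel_eq_if_solution_set_eq:
  fixes H :: "real ^ 'd ^ 'm" and K :: "real ^ 'd ^ 'k"
  assumes sol: "{x. H *v x = y} = {x. K *v x = z}" and x: "H *v x = y"
  shows "H *v u = 0 \<longleftrightarrow> K *v u = 0"
proof -
  have "K *v x = z" and "H *v (x + u) = y \<longleftrightarrow> K *v (x + u) = z"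
    using sol x by blast+
  with x show ?thesis
    by (simp add: matrix_vector_right_distrib)
qed

theorem corollary0p1:
  fixes M :: "'w measure" and S :: "'x measure"
    and X :: "'w \<Rightarrow> 'x" and N :: nat
    and T :: "'x \<Rightarrow> real ^ 'd"
    and Cv :: "real ^ 'd ^ 'd"
    and H1 :: "real ^ 'd ^ 'm1" and y1 :: "real ^ 'm1"
    and H2 :: "real ^ 'd ^ 'm2" and y2 :: "real ^ 'm2"
  assumes "prob_space M"
    and "X \<in> measurable M S"
    and "T \<in> borel_measurable S"
    and "square_integrable M (\<lambda>w. T (X w))"
    and "Cv = covariance_matrix M (\<lambda>w. T (X w))"
    and "CARD('m1) \<le> CARD('d)" and "CARD('m2) \<le> CARD('d)"
    and "{x. H1 *v x = y1} = {x. H2 *v x = y2}"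
    and "{x. H1 *v x = y1} \<noteq> {}"
  shows "(\<forall>\<theta>. H1 *v \<theta> = y1 \<longleftrightarrow> H2 *v \<theta> = y2) \<and>
    (positive_definite Cv \<longrightarrow>
      (\<forall>w\<in>space M. WTS N Cv (T (X w)) H1 y1 = WTS N Cv (T (X w)) H2 y2))"
proof (intro conjI impI ballI)
  show "\<forall>\<theta>. H1 *v \<theta> = y1 \<longleftrightarrow> H2 *v \<theta> = y2"
    using assms(8) by blast
next
  fix w
  assume pd: "positive_definite Cv"
  \<comment> \<open>The same base point serves both statistics, so both are quadratic forms in the
    one vector T(X) - x.\<close>
  obtain x where x: "H1 *v x = y1" "H2 *v x = y2"
    using assms(8,9) by blast
  have "wald_matrix Cv H1 = wald_matrix Cv H2"
    using kernel_eq_if_solution_set_eq[OF assms(8) x(1)] by (rule wald_matrix_cong_kernel[OF pd])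
  then show "WTS N Cv (T (X w)) H1 y1 = WTS N Cv (T (X w)) H2 y2"
    by (simp add: WTS_eq_wald_matrix[OF x(1)] WTS_eq_wald_matrix[OF x(2)])
qed

end
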